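(* Any non-adaptive sampling algorithm which solves, with probability at least $2/3$ (even allowing two-sided error), the PSD testing problem with $\epsilon$-$\ell_2^2$ gap must query at least $\tilde{\Omega}(1/\epsilon^2)$ entries of the input matrix.
   Context: PSD testing problem with $\epsilon$-$\ell_2^2$ gap: given $\epsilon\in(0,1]$ and query access to a symmetric matrix $\mathbf{A}\in\mathbb{R}^{n\times n}$ with $\max_{i,j}|\mathbf{A}_{i,j}|\le 1$, distinguish whether (1) $\mathbf{A}$ is positive semidefinite, or (2) $\min_{\mathbf{B}\succeq 0}\|\mathbf{A}-\mathbf{B}\|_F^2=\sum_{i:\lambda_i(\mathbf{A})<0}\lambda_i^2(\mathbf{A})\ge\epsilon n^2$, where $\lambda_i(\mathbf{A})$ are the eigenvalues of $\mathbf{A}$. A non-adaptive sampling algorithm fixes the set of queried entries before seeing any answers. $\tilde{\Omega}$ hides polylogarithmic factors in $1/\epsilon$.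
   Formalization: The bound is stated for matrix dimension n ≥ 1/ε; some such condition is needed, because for much smaller n reading all n² entries solves the problem with fewer than the claimed number of queries. *)

theory Defs
  imports
    "HOL-Probability.Probability_Mass_Function"
    "Jordan_Normal_Form.Matrix"
begin

definition symmetric_matrix :: "nat \<Rightarrow> real mat \<Rightarrow> bool" where
  "symmetric_matrix n A \<longleftrightarrow> A \<in> carrier_mat n n \<and> transpose_mat A = A"

definition psd :: "nat \<Rightarrow> real mat \<Rightarrow> bool" where
  "psd n A \<longleftrightarrow> symmetric_matrix n A \<and>
     (\<forall>x \<in> carrier_vec n. 0 \<le> scalar_prod x (A *\<^sub>v x))"

definition frobenius_norm :: "real mat \<Rightarrow> real" where
  "frobenius_norm A = sqrt (\<Sum>i<dim_row A. \<Sum>j<dim_col A. (A $$ (i, j))\<^sup>2)"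

text \<open>
  The minimum over the closed cone of positive semidefinite matrices is attained, so the
  infimum below is a minimum; by the spectral theorem it equals the sum of the squares of the
  negative eigenvalues of \<open>A\<close>, counted with multiplicity.
\<close>

definition sq_dist_psd :: "nat \<Rightarrow> real mat \<Rightarrow> real" where
  "sq_dist_psd n A = Inf {(frobenius_norm (A - B))\<^sup>2 | B. psd n B}"

definition bounded_input :: "nat \<Rightarrow> real mat \<Rightarrow> bool" where
  "bounded_input n A \<longleftrightarrow> symmetric_matrix n A \<and>
     (\<forall>i<n. \<forall>j<n. \<bar>A $$ (i, j)\<bar> \<le> 1)"

text \<open>
  A randomized non-adaptive algorithm draws a set of positions from \<open>query_dist\<close>,
  which does not depend on the input, and then accepts or rejects by means of
  \<open>decision S a\<close>, a distribution on Booleans (\<open>True\<close> = accept) that may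
  depend on the drawn set \<open>S\<close> and the answers \<open>a\<close>, but on nothing else.
  Random bits shared between the two phases give nothing more: \<open>decision S a\<close> may be
  taken to be their conditional law given \<open>S\<close>.  No computability or measurability is
  imposed on \<open>decision\<close>.
\<close>

record nonadaptive_algorithm =
  query_dist :: "(nat \<times> nat) set pmf"
  decision :: "(nat \<times> nat) set \<Rightarrow> (nat \<times> nat \<Rightarrow> real) \<Rightarrow> bool pmf"

definition answers :: "real mat \<Rightarrow> (nat \<times> nat) set \<Rightarrow> nat \<times> nat \<Rightarrow> real" where
  "answers A S = restrict (\<lambda>p. A $$ p) S"

definition output_dist :: "nonadaptive_algorithm \<Rightarrow> real mat \<Rightarrow> bool pmf" where
  "output_dist T A = bind_pmf (query_dist T) (\<lambda>S. decision T S (answers A S))"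

definition makes_at_most_queries :: "nat \<Rightarrow> nonadaptive_algorithm \<Rightarrow> nat \<Rightarrow> bool" where
  "makes_at_most_queries n T q \<longleftrightarrow>
     (\<forall>S \<in> set_pmf (query_dist T). S \<subseteq> {..<n} \<times> {..<n} \<and> card S \<le> q)"

definition solves_psd_testing :: "nat \<Rightarrow> real \<Rightarrow> nonadaptive_algorithm \<Rightarrow> bool" where
  "solves_psd_testing n \<epsilon> T \<longleftrightarrow>
     (\<forall>A. bounded_input n A \<longrightarrow>
        (psd n A \<longrightarrow> pmf (output_dist T A) True \<ge> 2 / 3) \<and>
        (sq_dist_psd n A \<ge> \<epsilon> * (real n)\<^sup>2 \<longrightarrow> pmf (output_dist T A) False \<ge> 2 / 3))"

end

theory Submission
  imports Defs "HOL-Number_Theory.Cong"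
begin

text \<open>
  The hard inputs are blow-ups of \<open>m\<close> disjoint signed cycles of even length \<open>k = 2 r\<close>, with
  \<open>k\<close> of order \<open>1 + ln (1 / \<epsilon>)\<close> and \<open>m\<close> of order \<open>1 / (\<epsilon> k\<^sup>6)\<close>. On each cycle the matrix
  is \<open>(1 - 2 / k\<^sup>2) I - W / 2\<close> with \<open>W\<close> the signed adjacency matrix. If the signs of a cycle multiply
  to \<open>- 1\<close>, an antiperiodic Poincare inequality makes this positive semidefinite; if they multiply
  to \<open>1\<close>, switching turns \<open>W\<close> into the unsigned cycle and the constant vector has Rayleigh
  quotient \<open>- 2 / k\<^sup>2\<close>. Blowing up by \<open>n / (k m)\<close> puts the second kind at squared distance at
  least \<open>n\<^sup>2 / (m k\<^sup>6)\<close> from the cone.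

  Index \<open>i\<close> sits at position \<open>i mod k\<close> of a cycle whose number is determined by \<open>i div k\<close> and a
  random shift, one shift for each position, so that all blow-up classes have almost equal size. With
  uniformly random signs subject to the product constraint, the two kinds give identically distributed
  answers unless some cycle has all its edges queried: otherwise flip one unqueried sign per cycle.
  For a fixed cycle, already the \<open>r\<close> alternate edges are all hit for at most \<open>q ^ r\<close> of the \<open>m ^ (2 r)\<close>
  shift vectors. The union bound over \<open>m \<le> 2 ^ r\<close> cycles forces \<open>q \<ge> m\<^sup>2 / 4\<close>.
\<close>

definition group_index :: "nat \<Rightarrow> nat \<Rightarrow> (nat \<Rightarrow> nat) \<Rightarrow> nat \<Rightarrow> nat" where
  "group_index m k h i = (i div k + h (i mod k)) mod m"

definition cell :: "nat \<Rightarrow> nat \<Rightarrow> (nat \<Rightarrow> nat) \<Rightarrow> nat \<Rightarrow> nat \<Rightarrow> nat \<Rightarrow> bool" where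
  "cell m k h g p i \<longleftrightarrow> i mod k = p \<and> group_index m k h i = g"

definition edge_sign :: "(nat \<times> nat) set \<Rightarrow> nat \<Rightarrow> nat \<Rightarrow> real" where
  "edge_sign X g p = (if (g, p) \<in> X then - 1 else 1)"

definition cycle_mat :: "nat \<Rightarrow> nat \<Rightarrow> nat \<Rightarrow> (nat \<Rightarrow> nat) \<Rightarrow> (nat \<times> nat) set \<Rightarrow> real mat" where
  "cycle_mat n m k h X = mat n n (\<lambda>(i, j). \<Sum>g<m. \<Sum>p<k.
     (1 - 2 / (real k)\<^sup>2) * (of_bool (cell m k h g p i) * of_bool (cell m k h g p j))
     - edge_sign X g p / 2 *
       (of_bool (cell m k h g p i) * of_bool (cell m k h g (Suc p mod k) j)
        + of_bool (cell m k h g (Suc p mod k) i) * of_bool (cell m k h g p j)))"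

definition sign_patterns :: "nat \<Rightarrow> nat \<Rightarrow> real \<Rightarrow> (nat \<times> nat) set set" where
  "sign_patterns m k b =
     {X. X \<subseteq> {..<m} \<times> {..<k} \<and> (\<forall>g<m. (\<Prod>p<k. edge_sign X g p) = b)}"

definition covers_edge ::
    "nat \<Rightarrow> nat \<Rightarrow> (nat \<Rightarrow> nat) \<Rightarrow> (nat \<times> nat) set \<Rightarrow> nat \<Rightarrow> nat \<Rightarrow> bool" where
  "covers_edge m k h S g p \<longleftrightarrow> (\<exists>(i, j) \<in> S.
     cell m k h g p i \<and> cell m k h g (Suc p mod k) j \<or>
     cell m k h g (Suc p mod k) i \<and> cell m k h g p j)"

lemma edge_sign_square [simp]: "edge_sign X g p * edge_sign X g p = 1"
  by (simp add: edge_sign_def)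

subsection \<open>Quadratic forms\<close>

lemma quadratic_form_eq_sum:
  assumes "A \<in> carrier_mat n n" "x \<in> carrier_vec n"
  shows "scalar_prod x (A *\<^sub>v x) = (\<Sum>i<n. \<Sum>j<n. x $ i * A $$ (i, j) * x $ j)"
  using assms
  by (auto simp: scalar_prod_def sum_distrib_left mult.assoc lessThan_atLeast0 intro!: sum.cong)

lemma psd_sum_nonneg:
  assumes "psd n B"
  shows "0 \<le> (\<Sum>i<n. \<Sum>j<n. x i * B $$ (i, j) * x j)"
proof -
  have B: "B \<in> carrier_mat n n" using assms by (auto simp: psd_def symmetric_matrix_def)
  have "0 \<le> scalar_prod (vec n x) (B *\<^sub>v vec n x)"
    using assms unfolding psd_def by (metis vec_carrier)
  also have "\<dots> = (\<Sum>i<n. \<Sum>j<n. x i * B $$ (i, j) * x j)"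
    by (subst quadratic_form_eq_sum[OF B]) auto
  finally show ?thesis .
qed

lemma quadratic_form_square_le:
  fixes C :: "nat \<Rightarrow> nat \<Rightarrow> real"
  assumes "finite I"
  shows "(\<Sum>i\<in>I. \<Sum>j\<in>I. v i * C i j * v j)\<^sup>2 \<le> (\<Sum>i\<in>I. \<Sum>j\<in>I. (C i j)\<^sup>2) * (\<Sum>i\<in>I. (v i)\<^sup>2)\<^sup>2"
proof -
  have "(\<Sum>i\<in>I. \<Sum>j\<in>I. v i * C i j * v j) = (\<Sum>z\<in>I\<times>I. C (fst z) (snd z) * (v (fst z) * v (snd z)))"
    by (simp add: sum.cartesian_product case_prod_beta mult_ac)
  moreover have "(\<Sum>z\<in>I\<times>I. (v (fst z) * v (snd z))\<^sup>2) = (\<Sum>i\<in>I. (v i)\<^sup>2)\<^sup>2"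
    by (simp add: power_mult_distrib power2_eq_square[of "sum _ _"] sum_product sum.cartesian_product
        case_prod_beta)
  moreover have "(\<Sum>z\<in>I\<times>I. (C (fst z) (snd z))\<^sup>2) = (\<Sum>i\<in>I. \<Sum>j\<in>I. (C i j)\<^sup>2)"
    by (simp add: sum.cartesian_product case_prod_beta)
  ultimately show ?thesis
    using Cauchy_Schwarz_ineq_sum[of "\<lambda>z. C (fst z) (snd z)" "\<lambda>z. v (fst z) * v (snd z)" "I\<times>I"]
    by simp
qed

lemma sq_dist_psd_ge:
  fixes v :: "nat \<Rightarrow> nat \<Rightarrow> real"
  assumes A: "A \<in> carrier_mat n n"
    and support: "\<And>g i. g < m \<Longrightarrow> i < n \<Longrightarrow> v g i \<noteq> 0 \<Longrightarrow> c i = g"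
    and form: "\<And>g. g < m \<Longrightarrow> (\<Sum>i<n. \<Sum>j<n. v g i * A $$ (i, j) * v g j) \<le> - Q"
    and norm: "\<And>g. g < m \<Longrightarrow> (\<Sum>i<n. (v g i)\<^sup>2) \<le> V"
    and "0 \<le> Q" "0 < V"
  shows "real m * (Q / V)\<^sup>2 \<le> sq_dist_psd n A"
  unfolding sq_dist_psd_def
proof (rule cInf_greatest)
  have "psd n (0\<^sub>m n n)"
    by (auto simp: psd_def symmetric_matrix_def scalar_prod_def)
  then show "{(frobenius_norm (A - B))\<^sup>2 |B. psd n B} \<noteq> {}" by blast
next
  fix d assume "d \<in> {(frobenius_norm (A - B))\<^sup>2 |B. psd n B}"
  then obtain B where d: "d = (frobenius_norm (A - B))\<^sup>2" and B: "psd n B" by blast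
  have Bc: "B \<in> carrier_mat n n" using B by (auto simp: psd_def symmetric_matrix_def)
  define C where "C i j = A $$ (i, j) - B $$ (i, j)" for i j
  define I where "I g = {i. i < n \<and> c i = g}" for g
  have d_eq: "d = (\<Sum>i<n. \<Sum>j<n. (C i j)\<^sup>2)"
    using A Bc unfolding d frobenius_norm_def C_def
    by (subst real_sqrt_pow2) (auto intro!: sum_nonneg sum.cong)
  have block: "(Q / V)\<^sup>2 \<le> (\<Sum>i\<in>I g. \<Sum>j\<in>I g. (C i j)\<^sup>2)" if g: "g < m" for g
  proof -
    have z: "v g i = 0" if "i < n" "i \<notin> I g" for i
      using support[OF g, of i] that by (auto simp: I_def)
    have I: "I g \<subseteq> {..<n}" "finite (I g)" by (auto simp: I_def)
    have "(\<Sum>i\<in>I g. \<Sum>j\<in>I g. v g i * C i j * v g j) = (\<Sum>i<n. \<Sum>j<n. v g i * C i j * v g j)"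
    proof -
      have "(\<Sum>j\<in>I g. v g i * C i j * v g j) = (\<Sum>j<n. v g i * C i j * v g j)" for i
        by (rule sum.mono_neutral_left) (use I z in auto)
      then show ?thesis
        by (simp, intro sum.mono_neutral_left) (use I z in auto)
    qed
    also have "\<dots> = (\<Sum>i<n. \<Sum>j<n. v g i * A $$ (i, j) * v g j)
        - (\<Sum>i<n. \<Sum>j<n. v g i * B $$ (i, j) * v g j)"
      by (simp add: C_def algebra_simps sum_subtractf)
    also have "\<dots> \<le> - Q" using form[OF g] psd_sum_nonneg[OF B, of "v g"] by linarith
    finally have "Q \<le> \<bar>\<Sum>i\<in>I g. \<Sum>j\<in>I g. v g i * C i j * v g j\<bar>" by linarith
    then have "Q\<^sup>2 \<le> (\<Sum>i\<in>I g. \<Sum>j\<in>I g. v g i * C i j * v g j)\<^sup>2"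
      using power_mono[of Q _ 2] \<open>0 \<le> Q\<close> by fastforce
    also have "\<dots> \<le> (\<Sum>i\<in>I g. \<Sum>j\<in>I g. (C i j)\<^sup>2) * (\<Sum>i\<in>I g. (v g i)\<^sup>2)\<^sup>2"
      by (rule quadratic_form_square_le[OF I(2)])
    also have "\<dots> \<le> (\<Sum>i\<in>I g. \<Sum>j\<in>I g. (C i j)\<^sup>2) * V\<^sup>2"
    proof (intro mult_left_mono power_mono sum_nonneg)
      have "(\<Sum>i\<in>I g. (v g i)\<^sup>2) \<le> (\<Sum>i<n. (v g i)\<^sup>2)" by (rule sum_mono2) (use I in auto)
      with norm[OF g] show "(\<Sum>i\<in>I g. (v g i)\<^sup>2) \<le> V" by linarith
    qed auto
    finally show ?thesis using \<open>0 < V\<close> by (simp add: power_divide divide_le_eq)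
  qed
  have "real m * (Q / V)\<^sup>2 = (\<Sum>g<m. (Q / V)\<^sup>2)" by simp
  also have "\<dots> \<le> (\<Sum>g<m. \<Sum>z\<in>I g \<times> I g. (C (fst z) (snd z))\<^sup>2)"
    by (rule sum_mono) (use block in \<open>simp add: sum.cartesian_product case_prod_beta\<close>)
  also have "\<dots> = (\<Sum>z\<in>(\<Union>g<m. I g \<times> I g). (C (fst z) (snd z))\<^sup>2)"
    by (rule sum.UNION_disjoint[symmetric]) (auto simp: I_def)
  also have "\<dots> \<le> (\<Sum>z\<in>{..<n} \<times> {..<n}. (C (fst z) (snd z))\<^sup>2)"
    by (rule sum_mono2) (auto simp: I_def)
  also have "\<dots> = d" by (simp add: d_eq sum.cartesian_product case_prod_beta)
  finally show "real m * (Q / V)\<^sup>2 \<le> d" .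
qed

subsection \<open>Signed cycles\<close>

lemma antiperiodic_poincare:
  fixes z :: "nat \<Rightarrow> real"
  assumes "z k = - z 0" "p < k"
  shows "4 * (z p)\<^sup>2 \<le> real k * (\<Sum>i<k. (z i - z (Suc i))\<^sup>2)"
proof -
  define s :: "nat \<Rightarrow> real" where "s i = (if i < p then - 1 else 1)" for i
  have s2: "(s i)\<^sup>2 = 1" for i by (simp add: s_def)
  have "(\<Sum>i<k. s i * (z i - z (Suc i)))
      = (\<Sum>i\<in>{0..<p}. s i * (z i - z (Suc i))) + (\<Sum>i\<in>{p..<k}. s i * (z i - z (Suc i)))"
    using assms by (simp add: lessThan_atLeast0 sum.atLeastLessThan_concat)
  also have "(\<Sum>i\<in>{0..<p}. s i * (z i - z (Suc i))) = (\<Sum>i\<in>{0..<p}. z (Suc i) - z i)"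
    by (rule sum.cong) (auto simp: s_def)
  also have "\<dots> = z p - z 0" by (rule sum_Suc_diff') simp
  also have "(\<Sum>i\<in>{p..<k}. s i * (z i - z (Suc i))) = - (\<Sum>i\<in>{p..<k}. z (Suc i) - z i)"
    unfolding sum_negf[symmetric] by (rule sum.cong) (auto simp: s_def)
  also have "(\<Sum>i\<in>{p..<k}. z (Suc i) - z i) = z k - z p"
    using assms by (intro sum_Suc_diff') simp
  finally have telescope: "2 * z p = (\<Sum>i<k. s i * (z i - z (Suc i)))" using assms by simp
  have "4 * (z p)\<^sup>2 = (2 * z p)\<^sup>2" by (simp add: power_mult_distrib)
  also have "\<dots> = (\<Sum>i<k. s i * (z i - z (Suc i)))\<^sup>2" by (simp only: telescope)
  also have "\<dots> \<le> (\<Sum>i<k. (s i)\<^sup>2) * (\<Sum>i<k. (z i - z (Suc i))\<^sup>2)"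
    by (rule Cauchy_Schwarz_ineq_sum)
  also have "(\<Sum>i<k. (s i)\<^sup>2) = real k" by (simp add: s2)
  finally show ?thesis .
qed

lemma unbalanced_cycle_nonneg:
  fixes w y :: "nat \<Rightarrow> real"
  assumes w: "\<And>p. w p * w p = 1" and unbalanced: "(\<Prod>p<k. w p) = - 1" and k: "0 < k"
  shows "0 \<le> (\<Sum>p<k. (1 - 2 / (real k)\<^sup>2) * (y p)\<^sup>2 - w p * (y p * y (Suc p mod k)))"
proof -
  define z where "z p = (\<Prod>i<p. w i) * y (p mod k)" for p
  define E where "E = (\<Sum>i<k. (z i - z (Suc i))\<^sup>2)"
  define N where "N = (\<Sum>p<k. (y p)\<^sup>2)"
  define R where "R = (\<Sum>p<k. w p * (y p * y (Suc p mod k)))"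
  have P: "(\<Prod>i<p. w i) * (\<Prod>i<p. w i) = 1" for p
    by (simp add: w flip: prod.distrib)
  have z2: "(z p)\<^sup>2 = (y (p mod k))\<^sup>2" for p
    using P[of p] by (simp add: z_def power_mult_distrib power2_eq_square)
  have zz: "z p * z (Suc p) = w p * (y (p mod k) * y (Suc p mod k))" for p
  proof -
    have "z p * z (Suc p) = ((\<Prod>i<p. w i) * (\<Prod>i<p. w i)) * (w p * (y (p mod k) * y (Suc p mod k)))"
      by (simp add: z_def)
    then show ?thesis by (simp add: P)
  qed
  have shift: "(\<Sum>p<k. (y (Suc p mod k))\<^sup>2) = N"
  proof -
    obtain j where j: "k = Suc j" using k gr0_implies_Suc by blast
    have "(\<Sum>p<k. (y (Suc p mod k))\<^sup>2) = (\<Sum>p<j. (y (Suc p))\<^sup>2) + (y 0)\<^sup>2"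
      by (simp add: j)
    also have "\<dots> = N" by (simp add: N_def j sum.lessThan_Suc_shift del: sum.lessThan_Suc)
    finally show ?thesis .
  qed
  have "E = (\<Sum>p<k. (y p)\<^sup>2 + (y (Suc p mod k))\<^sup>2 - 2 * (w p * (y p * y (Suc p mod k))))"
    unfolding E_def
  proof (rule sum.cong)
    fix p assume "p \<in> {..<k}"
    then show "(z p - z (Suc p))\<^sup>2 = (y p)\<^sup>2 + (y (Suc p mod k))\<^sup>2 - 2 * (w p * (y p * y (Suc p mod k)))"
      using z2[of p] z2[of "Suc p"] zz[of p] by (simp add: power2_diff)
  qed simp
  then have E: "E = 2 * N - 2 * R"
    by (simp add: sum.distrib sum_subtractf shift N_def R_def flip: sum_distrib_left)
  have "4 * (y p)\<^sup>2 \<le> real k * E" if "p < k" for p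
    using antiperiodic_poincare[of z k p] that z2[of p] unbalanced
    by (simp add: E_def) (simp add: z_def)
  then have "(\<Sum>p<k. 4 * (y p)\<^sup>2) \<le> (\<Sum>p<k. real k * E)" by (intro sum_mono) auto
  then have "4 * N \<le> (real k)\<^sup>2 * E" by (simp add: N_def sum_distrib_left power2_eq_square)
  then have "2 / (real k)\<^sup>2 * N \<le> N - R" using k E by (simp add: field_simps)
  moreover have "(\<Sum>p<k. (1 - 2 / (real k)\<^sup>2) * (y p)\<^sup>2 - w p * (y p * y (Suc p mod k)))
      = (1 - 2 / (real k)\<^sup>2) * N - R"
    unfolding N_def R_def sum_distrib_left sum_subtractf ..
  ultimately show ?thesis by (simp add: left_diff_distrib)
qed

lemma balanced_cycle_switching:
  fixes w :: "nat \<Rightarrow> real"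
  assumes w: "\<And>p. w p * w p = 1" and balanced: "(\<Prod>p<k. w p) = 1" and p: "p < k"
  shows "w p * ((\<Prod>i<p. w i) * (\<Prod>i<Suc p mod k. w i)) = 1"
proof -
  have "(\<Prod>i<Suc p mod k. w i) = (\<Prod>i<Suc p. w i)"
    using p balanced by (cases "Suc p = k") auto
  then have "w p * ((\<Prod>i<p. w i) * (\<Prod>i<Suc p mod k. w i))
      = ((\<Prod>i<p. w i) * (\<Prod>i<p. w i)) * (w p * w p)"
    by simp
  also have "(\<Prod>i<p. w i) * (\<Prod>i<p. w i) = 1"
    by (simp add: w flip: prod.distrib)
  finally show ?thesis using w by simp
qed


subsection \<open>The hard matrices\<close>

lemma cycle_mat_carrier [simp]: "cycle_mat n m k h X \<in> carrier_mat n n"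
  by (simp add: cycle_mat_def)

lemma cycle_mat_symmetric: "symmetric_matrix n (cycle_mat n m k h X)"
  unfolding symmetric_matrix_def
proof
  show "transpose_mat (cycle_mat n m k h X) = cycle_mat n m k h X"
    by (rule eq_matI) (auto simp: cycle_mat_def mult.commute add.commute intro!: sum.cong)
qed simp

lemma quadratic_form_cycle_mat:
  fixes x h n m k
  defines "y g p \<equiv> \<Sum>i<n. x i * of_bool (cell m k h g p i)"
  shows "(\<Sum>i<n. \<Sum>j<n. x i * cycle_mat n m k h X $$ (i, j) * x j) =
    (\<Sum>g<m. \<Sum>p<k. (1 - 2 / (real k)\<^sup>2) * (y g p)\<^sup>2
        - edge_sign X g p * (y g p * y g (Suc p mod k)))"
proof -
  define e where "e g p i = (of_bool (cell m k h g p i) :: real)" for g p i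
  define a where "a = 1 - 2 / (real k)\<^sup>2"
  define T where "T g p i j = a * (e g p i * e g p j) - edge_sign X g p / 2 *
    (e g p i * e g (Suc p mod k) j + e g (Suc p mod k) i * e g p j)" for g p i j
  have y: "y g p = (\<Sum>i<n. x i * e g p i)" for g p by (simp add: y_def e_def)
  have prod: "(\<Sum>i<n. (x i * e g p i) * (\<Sum>j<n. x j * e g' p' j)) = y g p * y g' p'" for g p g' p'
    by (simp add: y sum_distrib_right)
  have T: "(\<Sum>i<n. \<Sum>j<n. x i * T g p i j * x j)
      = a * (y g p)\<^sup>2 - edge_sign X g p * (y g p * y g (Suc p mod k))" for g p
  proof -
    have "x i * T g p i j * x j = a * ((x i * e g p i) * (x j * e g p j)) - edge_sign X g p / 2 *
      ((x i * e g p i) * (x j * e g (Suc p mod k) j) + (x i * e g (Suc p mod k) i) * (x j * e g p j))"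
      for i j by (simp add: T_def algebra_simps)
    then have "(\<Sum>i<n. \<Sum>j<n. x i * T g p i j * x j) = a * (y g p * y g p) - edge_sign X g p / 2 *
      (y g p * y g (Suc p mod k) + y g (Suc p mod k) * y g p)"
      by (simp only: sum_subtractf sum.distrib prod flip: sum_distrib_left)
    then show ?thesis by (simp add: power2_eq_square)
  qed
  have "(\<Sum>i<n. \<Sum>j<n. x i * cycle_mat n m k h X $$ (i, j) * x j)
      = (\<Sum>i<n. \<Sum>j<n. \<Sum>g<m. \<Sum>p<k. x i * T g p i j * x j)"
    by (intro sum.cong refl)
      (simp add: cycle_mat_def T_def e_def a_def sum_distrib_left sum_distrib_right)
  also have "\<dots> = (\<Sum>i<n. \<Sum>g<m. \<Sum>j<n. \<Sum>p<k. x i * T g p i j * x j)"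
    by (intro sum.cong refl sum.swap)
  also have "\<dots> = (\<Sum>i<n. \<Sum>g<m. \<Sum>p<k. \<Sum>j<n. x i * T g p i j * x j)"
    by (intro sum.cong refl sum.swap)
  also have "\<dots> = (\<Sum>g<m. \<Sum>i<n. \<Sum>p<k. \<Sum>j<n. x i * T g p i j * x j)"
    by (rule sum.swap)
  also have "\<dots> = (\<Sum>g<m. \<Sum>p<k. \<Sum>i<n. \<Sum>j<n. x i * T g p i j * x j)"
    by (intro sum.cong refl sum.swap)
  finally show ?thesis by (simp add: T a_def)
qed

lemma cycle_mat_psd:
  assumes "X \<in> sign_patterns m k (- 1)" "0 < k"
  shows "psd n (cycle_mat n m k h X)"
  unfolding psd_def
proof (intro conjI ballI cycle_mat_symmetric)
  fix x :: "real vec" assume x: "x \<in> carrier_vec n"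
  show "0 \<le> scalar_prod x (cycle_mat n m k h X *\<^sub>v x)"
    unfolding quadratic_form_eq_sum[OF cycle_mat_carrier x] quadratic_form_cycle_mat
  proof (rule sum_nonneg)
    fix g assume "g \<in> {..<m}"
    then have "(\<Prod>p<k. edge_sign X g p) = - 1" using assms by (simp add: sign_patterns_def)
    from unbalanced_cycle_nonneg[OF edge_sign_square this \<open>0 < k\<close>]
    show "0 \<le> (\<Sum>p<k. (1 - 2 / (real k)\<^sup>2) * (\<Sum>i<n. x $ i * of_bool (cell m k h g p i))\<^sup>2
      - edge_sign X g p * ((\<Sum>i<n. x $ i * of_bool (cell m k h g p i))
        * (\<Sum>i<n. x $ i * of_bool (cell m k h g (Suc p mod k) i))))" .
  qed
qed

lemma cycle_mat_bounded:
  assumes k: "2 \<le> k"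
  shows "bounded_input n (cycle_mat n m k h X)"
  unfolding bounded_input_def
proof (intro conjI allI impI cycle_mat_symmetric)
  fix i j assume ij: "i < n" "j < n"
  define a where "a = 1 - 2 / (real k)\<^sup>2"
  have "2 \<le> (real k)\<^sup>2" using power_mono[of 2 "real k" 2] k by simp
  then have a: "0 \<le> a" "a \<le> 1" by (auto simp: a_def divide_le_eq)
  have neq: "Suc p mod k \<noteq> p" if "p < k" for p
    using k that by (cases "Suc p = k") auto
  define e where "e g p i = (of_bool (cell m k h g p i) :: real)" for g p i
  define gi where "gi = group_index m k h i"
  define gj where "gj = group_index m k h j"
  have e_i: "e g p i = of_bool (p = i mod k) * of_bool (g = gi)"
    and e_j: "e g p j = of_bool (p = j mod k) * of_bool (g = gj)" for g p
    by (auto simp: e_def cell_def gi_def gj_def)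
  define T where "T g p = a * (e g p i * e g p j) - edge_sign X g p / 2 *
    (e g p i * e g (Suc p mod k) j + e g (Suc p mod k) i * e g p j)" for g p
  define b where "b p = of_bool (p = i mod k \<and> p = j mod k) * a
    + of_bool (p = i mod k \<and> Suc p mod k = j mod k) / 2
    + of_bool (p = j mod k \<and> Suc p mod k = i mod k) / 2" for p
  have b: "0 \<le> b p" for p using a by (simp add: b_def)
  have Tb: "\<bar>T g p\<bar> \<le> of_bool (g = gi) * b p" for g p
  proof -
    define u v w where uvw: "u = e g p i * e g p j" "v = e g p i * e g (Suc p mod k) j"
      "w = e g (Suc p mod k) i * e g p j"
    have u: "u \<le> of_bool (g = gi) * of_bool (p = i mod k \<and> p = j mod k)"
      and v: "v \<le> of_bool (g = gi) * of_bool (p = i mod k \<and> Suc p mod k = j mod k)"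
      and w: "w \<le> of_bool (g = gi) * of_bool (p = j mod k \<and> Suc p mod k = i mod k)"
      by (simp_all add: uvw e_i e_j)
    have "0 \<le> u" "0 \<le> v" "0 \<le> w" by (simp_all add: uvw e_def)
    moreover have "T g p = a * u - edge_sign X g p / 2 * (v + w)" by (simp add: T_def uvw)
    moreover have "0 \<le> a * u" using a \<open>0 \<le> u\<close> by simp
    ultimately have "\<bar>T g p\<bar> \<le> a * u + v / 2 + w / 2"
      by (cases "(g, p) \<in> X") (simp_all add: edge_sign_def abs_le_iff add_divide_distrib)
    also have "\<dots> \<le> a * (of_bool (g = gi) * of_bool (p = i mod k \<and> p = j mod k))
      + of_bool (g = gi) * of_bool (p = i mod k \<and> Suc p mod k = j mod k) / 2
      + of_bool (g = gi) * of_bool (p = j mod k \<and> Suc p mod k = i mod k) / 2"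
      using u v w a by (intro add_mono mult_left_mono divide_right_mono) auto
    also have "\<dots> = of_bool (g = gi) * b p" by (simp only: b_def distrib_left mult_ac times_divide_eq_right)
    finally show ?thesis .
  qed
  have "\<bar>cycle_mat n m k h X $$ (i, j)\<bar> = \<bar>\<Sum>g<m. \<Sum>p<k. T g p\<bar>"
    using ij by (simp add: cycle_mat_def T_def e_def a_def)
  also have "\<dots> \<le> (\<Sum>g<m. \<Sum>p<k. \<bar>T g p\<bar>)"
    by (intro order.trans[OF sum_abs] sum_mono order.refl)
  also have "\<dots> \<le> (\<Sum>g<m. \<Sum>p<k. of_bool (g = gi) * b p)" by (intro sum_mono Tb)
  also have "\<dots> = (\<Sum>g<m. of_bool (g = gi)) * (\<Sum>p<k. b p)" by (simp only: sum_product)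
  also have "\<dots> \<le> 1 * 1"
  proof (rule mult_mono)
    show "(\<Sum>g<m. of_bool (g = gi) :: real) \<le> 1" by (simp add: of_bool_def)
    have "b p \<le> of_bool (p = i mod k) / 2 + of_bool (p = j mod k) / 2" if "p < k" for p
    proof (cases "i mod k = j mod k")
      case True
      then show ?thesis using a neq[OF that] by (auto simp: b_def)
    next
      case False
      then have z: "of_bool (p = i mod k \<and> p = j mod k) = (0::real)" by auto
      have "of_bool (p = i mod k \<and> Suc p mod k = j mod k) \<le> (of_bool (p = i mod k) :: real)"
        "of_bool (p = j mod k \<and> Suc p mod k = i mod k) \<le> (of_bool (p = j mod k) :: real)"
        by simp_all
      then show ?thesis unfolding b_def z by linarith
    qed
    then have "(\<Sum>p<k. b p) \<le> (\<Sum>p<k. of_bool (p = i mod k) / 2 + of_bool (p = j mod k) / 2)"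
      by (intro sum_mono) auto
    also have "\<dots> = (\<Sum>p<k. of_bool (p = i mod k)) / 2 + (\<Sum>p<k. of_bool (p = j mod k)) / 2"
      by (simp only: sum.distrib sum_divide_distrib)
    also have "\<dots> = 1" using k by (simp add: of_bool_def)
    finally show "(\<Sum>p<k. b p) \<le> 1" .
  qed (auto intro!: sum_nonneg b)
  finally show "\<bar>cycle_mat n m k h X $$ (i, j)\<bar> \<le> 1" by simp
qed

lemma card_cell_ge:
  assumes "g < m" "p < k"
  shows "n div (k * m) \<le> card {i. i < n \<and> cell m k h g p i}"
proof -
  define c where "c = (g + (m - h p mod m)) mod m"
  define f where "f t = k * (m * t + c) + p" for t
  have m: "0 < m" using assms by simp
  have c: "c < m" using m by (simp add: c_def)
  have "(c + h p) mod m = (g + (m - h p mod m) + h p mod m) mod m"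
    by (simp only: c_def mod_add_left_eq mod_add_right_eq)
  also have "\<dots> = (g + ((m - h p mod m) + h p mod m)) mod m" by (simp only: add.assoc)
  also have "(m - h p mod m) + h p mod m = m" using m by (simp add: less_imp_le)
  finally have shift: "(c + h p) mod m = g" using assms by simp
  have f_cell: "cell m k h g p (f t)" for t
    using assms shift by (simp add: cell_def group_index_def f_def add.assoc)
  have f_less: "f t < n" if "t < n div (k * m)" for t
  proof -
    have "f t < k * (m * t + c + 1)" using assms by (simp add: f_def)
    also have "\<dots> \<le> k * (m * (t + 1))" using c by (intro mult_left_mono) auto
    also have "\<dots> = (k * m) * (t + 1)" by (simp only: mult.assoc)
    also have "\<dots> \<le> (k * m) * (n div (k * m))" using that by (intro mult_left_mono) auto
    also have "\<dots> \<le> n" by simp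
    finally show ?thesis .
  qed
  have "inj_on f {..<n div (k * m)}" using assms m by (auto simp: inj_on_def f_def)
  then have "card (f ` {..<n div (k * m)}) = n div (k * m)" by (simp add: card_image)
  moreover have "f ` {..<n div (k * m)} \<subseteq> {i. i < n \<and> cell m k h g p i}"
    using f_cell f_less by auto
  ultimately show ?thesis
    using card_mono[of "{i. i < n \<and> cell m k h g p i}" "f ` {..<n div (k * m)}"] by simp
qed

lemma cycle_mat_far:
  assumes X: "X \<in> sign_patterns m k 1" and k: "0 < k" and s: "0 < n div (k * m)"
  shows "real m * (2 * real (n div (k * m)) / (real k)\<^sup>2)\<^sup>2 \<le> sq_dist_psd n (cycle_mat n m k h X)"
proof -
  define s where "s = n div (k * m)"
  define N where "N g p = real (card {i. i < n \<and> cell m k h g p i})" for g p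
  define e where "e g p i = (of_bool (cell m k h g p i) :: real)" for g p i
  define \<sigma> where "\<sigma> g p = (\<Prod>i<p. edge_sign X g i)" for g p
  define v where "v g i = (\<Sum>p<k. e g p i * (\<sigma> g p / N g p))" for g i
  have \<sigma>: "\<sigma> g p * \<sigma> g p = 1" for g p by (simp add: \<sigma>_def flip: prod.distrib)
  have N: "real s \<le> N g p" if "g < m" "p < k" for g p
    using card_cell_ge[OF that] by (simp add: N_def s_def)
  have sum_e: "(\<Sum>i<n. e g p i) = N g p" for g p
  proof -
    have "(\<Sum>i<n. e g p i) = (\<Sum>i\<in>{i\<in>{..<n}. cell m k h g p i}. 1)"
      by (simp add: e_def of_bool_def sum.If_cases Int_def)
    then show ?thesis by (simp add: N_def)
  qed
  have e_e: "e g p i * e g' p' i = of_bool (g = g' \<and> p = p') * e g p i" for g g' p p' i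
    by (auto simp: e_def cell_def)
  have v_sum: "(\<Sum>i<n. v g i * e g' p i) = of_bool (g = g') * \<sigma> g p" if "g < m" "g' < m" "p < k" for g g' p
  proof -
    have "(\<Sum>i<n. v g i * e g' p i) = (\<Sum>i<n. \<Sum>p'<k. e g p' i * e g' p i * (\<sigma> g p' / N g p'))"
      by (simp add: v_def sum_distrib_left sum_distrib_right mult_ac)
    also have "\<dots> = (\<Sum>i<n. \<Sum>p'<k. if p' = p then e g p i * (of_bool (g = g') * (\<sigma> g p / N g p)) else 0)"
      by (intro sum.cong refl) (auto simp: e_e)
    also have "\<dots> = (\<Sum>i<n. e g p i) * (of_bool (g = g') * (\<sigma> g p / N g p))"
      using that by (simp only: sum_distrib_right) simp
    also have "\<dots> = of_bool (g = g') * \<sigma> g p"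
      using N[of g p] that s by (simp add: sum_e s_def)
    finally show ?thesis .
  qed
  have "real m * ((2 / real k) / (real k / real s))\<^sup>2 \<le> sq_dist_psd n (cycle_mat n m k h X)"
  proof (rule sq_dist_psd_ge[where v = v and c = "group_index m k h"])
    fix g i assume "v g i \<noteq> 0"
    then show "group_index m k h i = g"
      by (auto simp: v_def e_def cell_def intro: ccontr)
  next
    fix g assume g: "g < m"
    have "(\<Sum>i<n. \<Sum>j<n. v g i * cycle_mat n m k h X $$ (i, j) * v g j) =
      (\<Sum>g'<m. \<Sum>p<k. (1 - 2 / (real k)\<^sup>2) * (of_bool (g = g') * \<sigma> g p)\<^sup>2
        - edge_sign X g' p * ((of_bool (g = g') * \<sigma> g p) * (of_bool (g = g') * \<sigma> g (Suc p mod k))))"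
      unfolding quadratic_form_cycle_mat e_def[symmetric]
      using g k by (intro sum.cong refl) (simp add: v_sum)
    also have "\<dots> = (\<Sum>g'<m. if g = g' then (\<Sum>p<k. (1 - 2 / (real k)\<^sup>2) * (\<sigma> g p)\<^sup>2
        - edge_sign X g p * (\<sigma> g p * \<sigma> g (Suc p mod k))) else 0)"
      by (intro sum.cong refl) auto
    also have "\<dots> = (\<Sum>p<k. (1 - 2 / (real k)\<^sup>2) * (\<sigma> g p)\<^sup>2
        - edge_sign X g p * (\<sigma> g p * \<sigma> g (Suc p mod k)))"
      using g by (subst sum.delta') auto
    also have "\<dots> = (\<Sum>p<k. - 2 / (real k)\<^sup>2)"
    proof (rule sum.cong)
      fix p assume "p \<in> {..<k}"
      then have "edge_sign X g p * (\<sigma> g p * \<sigma> g (Suc p mod k)) = 1"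
        unfolding \<sigma>_def using X g
        by (intro balanced_cycle_switching) (auto simp: sign_patterns_def)
      then show "(1 - 2 / (real k)\<^sup>2) * (\<sigma> g p)\<^sup>2 - edge_sign X g p * (\<sigma> g p * \<sigma> g (Suc p mod k))
          = - 2 / (real k)\<^sup>2"
        by (simp add: power2_eq_square[of "\<sigma> g p"] \<sigma>)
    qed simp
    also have "\<dots> = - (2 / real k)" using k by (simp add: power2_eq_square)
    finally show "(\<Sum>i<n. \<Sum>j<n. v g i * cycle_mat n m k h X $$ (i, j) * v g j) \<le> - (2 / real k)"
      by simp
  next
    fix g assume g: "g < m"
    have "(\<Sum>i<n. (v g i)\<^sup>2) = (\<Sum>i<n. \<Sum>p<k. v g i * e g p i * (\<sigma> g p / N g p))"
      by (simp add: power2_eq_square sum_distrib_left mult.assoc)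
        (simp add: v_def sum_distrib_left mult.assoc)
    also have "\<dots> = (\<Sum>p<k. (\<Sum>i<n. v g i * e g p i) * (\<sigma> g p / N g p))"
      by (subst sum.swap) (simp only: sum_distrib_right)
    also have "\<dots> = (\<Sum>p<k. 1 / N g p)"
      using g by (intro sum.cong refl) (simp add: v_sum \<sigma>)
    also have "\<dots> \<le> (\<Sum>p<k. 1 / real s)"
      using g N s by (intro sum_mono divide_left_mono) (force simp: s_def intro: mult_pos_pos less_le_trans)+
    finally show "(\<Sum>i<n. (v g i)\<^sup>2) \<le> real k / real s" by simp
  qed (use k s in \<open>auto simp: s_def\<close>)
  then show ?thesis by (simp add: s_def power2_eq_square)
qed


subsection \<open>Indistinguishability\<close>

definition flip_signs :: "nat \<Rightarrow> (nat \<Rightarrow> nat) \<Rightarrow> (nat \<times> nat) set \<Rightarrow> (nat \<times> nat) set" where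
  "flip_signs m e X = sym_diff X ((\<lambda>g. (g, e g)) ` {..<m})"

lemma flip_signs_involution [simp]: "flip_signs m e (flip_signs m e X) = X"
  by (auto simp: flip_signs_def)

lemma edge_sign_flip_signs:
  "edge_sign (flip_signs m e X) g p = (if g < m \<and> p = e g then - edge_sign X g p else edge_sign X g p)"
  by (auto simp: flip_signs_def edge_sign_def)

lemma flip_signs_in_sign_patterns:
  assumes X: "X \<in> sign_patterns m k b" and e: "\<And>g. g < m \<Longrightarrow> e g < k"
  shows "flip_signs m e X \<in> sign_patterns m k (- b)"
  unfolding sign_patterns_def
proof (intro CollectI conjI allI impI)
  show "flip_signs m e X \<subseteq> {..<m} \<times> {..<k}"
    using X e by (auto simp: flip_signs_def sign_patterns_def)
next
  fix g assume g: "g < m"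
  have "(\<Prod>p<k. edge_sign (flip_signs m e X) g p)
      = edge_sign (flip_signs m e X) g (e g) * (\<Prod>p\<in>{..<k} - {e g}. edge_sign (flip_signs m e X) g p)"
    using e[OF g] by (intro prod.remove) auto
  also have "(\<Prod>p\<in>{..<k} - {e g}. edge_sign (flip_signs m e X) g p)
      = (\<Prod>p\<in>{..<k} - {e g}. edge_sign X g p)"
    by (intro prod.cong) (auto simp: edge_sign_flip_signs)
  also have "edge_sign (flip_signs m e X) g (e g) * \<dots>
      = - (edge_sign X g (e g) * (\<Prod>p\<in>{..<k} - {e g}. edge_sign X g p))"
    using g by (simp add: edge_sign_flip_signs)
  also have "edge_sign X g (e g) * (\<Prod>p\<in>{..<k} - {e g}. edge_sign X g p) = (\<Prod>p<k. edge_sign X g p)"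
    using e[OF g] by (intro prod.remove[symmetric]) auto
  also have "\<dots> = b" using X g by (simp add: sign_patterns_def)
  finally show "(\<Prod>p<k. edge_sign (flip_signs m e X) g p) = - b" .
qed

lemma sum_sign_patterns_flip:
  fixes F :: "(nat \<times> nat) set \<Rightarrow> 'a :: comm_monoid_add"
  assumes "\<And>g. g < m \<Longrightarrow> e g < k"
  shows "(\<Sum>X\<in>sign_patterns m k (- b). F X) = (\<Sum>X\<in>sign_patterns m k b. F (flip_signs m e X))"
  by (rule sum.reindex_bij_witness[of _ "flip_signs m e" "flip_signs m e"])
    (use assms flip_signs_in_sign_patterns[of _ m k "- b" e] flip_signs_in_sign_patterns[of _ m k b e]
      in auto)

lemma finite_sign_patterns [simp]: "finite (sign_patterns m k b)"
  by (rule finite_subset[of _ "Pow ({..<m} \<times> {..<k})"]) (auto simp: sign_patterns_def)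

lemma card_sign_patterns_uminus:
  assumes "0 < k"
  shows "card (sign_patterns m k (- b)) = card (sign_patterns m k b)"
  using sum_sign_patterns_flip[of m "\<lambda>_. 0" k "\<lambda>_. 1 :: nat" b] assms by simp

lemma card_sign_patterns_pos: "0 < card (sign_patterns m k 1)"
proof -
  have "{} \<in> sign_patterns m k 1" by (auto simp: sign_patterns_def edge_sign_def)
  then show ?thesis by (auto simp: card_gt_0_iff)
qed

lemma answers_flip_signs:
  assumes S: "S \<subseteq> {..<n} \<times> {..<n}"
    and uncovered: "\<And>g. g < m \<Longrightarrow> \<not> covers_edge m k h S g (e g)"
  shows "answers (cycle_mat n m k h (flip_signs m e X)) S = answers (cycle_mat n m k h X) S"
proof
  fix z
  show "answers (cycle_mat n m k h (flip_signs m e X)) S z = answers (cycle_mat n m k h X) S z"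
  proof (cases "z \<in> S")
    case True
    then obtain i j where z: "z = (i, j)" "(i, j) \<in> S" "i < n" "j < n" using S by (cases z) auto
    have "(of_bool (cell m k h g p i) * of_bool (cell m k h g (Suc p mod k) j)
        + of_bool (cell m k h g (Suc p mod k) i) * of_bool (cell m k h g p j) :: real) = 0"
      if "g < m" "p = e g" for g p
      using uncovered[OF \<open>g < m\<close>] z that unfolding covers_edge_def by fastforce
    then have "edge_sign (flip_signs m e X) g p / 2 *
         (of_bool (cell m k h g p i) * of_bool (cell m k h g (Suc p mod k) j)
        + of_bool (cell m k h g (Suc p mod k) i) * of_bool (cell m k h g p j) :: real)
      = edge_sign X g p / 2 *
         (of_bool (cell m k h g p i) * of_bool (cell m k h g (Suc p mod k) j)
        + of_bool (cell m k h g (Suc p mod k) i) * of_bool (cell m k h g p j))" for g p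
      by (cases "g < m \<and> p = e g") (simp_all add: edge_sign_flip_signs)
    then show ?thesis
      using z by (simp only: answers_def restrict_apply' cycle_mat_def index_mat case_prod_conv)
  qed (simp add: answers_def)
qed

lemma cell_determines_shift:
  assumes "cell m k h g p x" "cell m k h' g p x" "h p < m" "h' p < m"
  shows "h p = h' p"
proof -
  have "[x div k + h p = x div k + h' p] (mod m)"
    using assms by (auto simp: cell_def group_index_def cong_def)
  then have "[h p = h' p] (mod m)" by (simp only: cong_add_lcancel_nat)
  then show ?thesis using assms by (simp add: cong_def)
qed

text \<open>Covering every second edge of the cycle already determines all the shifts, because these
  edges form a perfect matching of the positions.\<close>

lemma card_shifts_covering_cycle:
  assumes "finite S"
  shows "card {h \<in> {..<2 * r} \<rightarrow>\<^sub>E {..<m}. \<forall>p<2 * r. covers_edge m (2 * r) h S g p} \<le> card S ^ r"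
proof -
  define k where "k = 2 * r"
  define H where "H = {h \<in> {..<k} \<rightarrow>\<^sub>E {..<m}. \<forall>p<k. covers_edge m k h S g p}"
  define meets where "meets h j z \<longleftrightarrow>
      cell m k h g (2 * j) (fst z) \<and> cell m k h g (2 * j + 1) (snd z) \<or>
      cell m k h g (2 * j + 1) (fst z) \<and> cell m k h g (2 * j) (snd z)" for h j z
  define query where "query h j = (SOME z. z \<in> S \<and> meets h j z)" for h j
  have query: "query h j \<in> S \<and> meets h j (query h j)" if "h \<in> H" "j < r" for h j
  proof -
    have "covers_edge m k h S g (2 * j)" using that by (auto simp: H_def k_def)
    moreover have "Suc (2 * j) mod k = 2 * j + 1" using that by (simp add: k_def)
    ultimately have "\<exists>z. z \<in> S \<and> meets h j z" by (auto simp: covers_edge_def meets_def)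
    then show ?thesis unfolding query_def by (rule someI_ex)
  qed
  have "inj_on (\<lambda>h. restrict (query h) {..<r}) H"
  proof (rule inj_onI)
    fix h h' assume h: "h \<in> H" "h' \<in> H" and eq: "restrict (query h) {..<r} = restrict (query h') {..<r}"
    have "h p = h' p" if p: "p < k" for p
    proof -
      define j where "j = p div 2"
      have j: "j < r" using p by (auto simp: j_def k_def)
      have "query h j = query h' j" using fun_cong[OF eq, of j] j by simp
      then have "meets h j (query h j)" "meets h' j (query h j)"
        using query[OF h(1) j] query[OF h(2) j] by auto
      moreover have "p = 2 * j \<or> p = 2 * j + 1" by (auto simp: j_def)
      moreover have "cell m k h g a x \<Longrightarrow> cell m k h' g b x \<Longrightarrow> a = b" for a b x
        by (simp add: cell_def)
      ultimately obtain x where "cell m k h g p x" "cell m k h' g p x"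
        unfolding meets_def by (metis Suc_eq_plus1 n_not_Suc_n)
      moreover have "h p < m" "h' p < m" using h p by (auto simp: H_def)
      ultimately show ?thesis by (rule cell_determines_shift)
    qed
    then show "h = h'" using h by (intro PiE_ext[of _ "{..<k}" "\<lambda>_. {..<m}"]) (auto simp: H_def)
  qed
  moreover have "(\<lambda>h. restrict (query h) {..<r}) ` H \<subseteq> {..<r} \<rightarrow>\<^sub>E S"
    unfolding image_subset_iff restrict_PiE_iff using query by blast
  moreover have "finite ({..<r} \<rightarrow>\<^sub>E S)" using assms by (intro finite_PiE) auto
  ultimately have "card H \<le> card ({..<r} \<rightarrow>\<^sub>E S)" by (rule card_inj_on_le)
  then show ?thesis by (simp add: card_PiE H_def k_def)
qed

definition acceptance :: "nonadaptive_algorithm \<Rightarrow> (nat \<times> nat) set \<Rightarrow> real mat \<Rightarrow> real" where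
  "acceptance T S A = pmf (decision T S (answers A S)) True"

lemma sum_acceptance_diff_le:
  fixes m n q r :: nat
  assumes S: "S \<subseteq> {..<n} \<times> {..<n}" and q: "card S \<le> q" and r: "0 < r"
  defines "H \<equiv> {..<2 * r} \<rightarrow>\<^sub>E {..<m}"
  shows "(\<Sum>(h, X)\<in>H \<times> sign_patterns m (2 * r) (- 1). acceptance T S (cycle_mat n m (2 * r) h X))
    - (\<Sum>(h, X)\<in>H \<times> sign_patterns m (2 * r) 1. acceptance T S (cycle_mat n m (2 * r) h X))
    \<le> real m * real q ^ r * real (card (sign_patterns m (2 * r) 1))"
proof -
  define k where "k = 2 * r"
  have k: "0 < k" using r by (simp add: k_def)
  define W where "W b = sign_patterns m k b" for b
  define acc where "acc h X = acceptance T S (cycle_mat n m k h X)" for h X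
  define diff where "diff h = (\<Sum>X\<in>W (- 1). acc h X) - (\<Sum>X\<in>W 1. acc h X)" for h
  define covered where "covered g = {h \<in> H. \<forall>p<k. covers_edge m k h S g p}" for g
  define Bad where "Bad = (\<Union>g<m. covered g)"
  have H: "finite H" unfolding H_def by (intro finite_PiE) auto
  have acc: "0 \<le> acc h X" "acc h X \<le> 1" for h X by (simp_all add: acc_def acceptance_def pmf_le_1)
  have bad: "diff h \<le> real (card (W 1))" for h
  proof -
    have "(\<Sum>X\<in>W (- 1). acc h X) \<le> (\<Sum>X\<in>W (- 1). 1)" by (intro sum_mono acc)
    also have "\<dots> = real (card (W 1))" using card_sign_patterns_uminus[OF k, of m 1] by (simp add: W_def)
    finally show ?thesis using sum_nonneg[of "W 1" "acc h"] acc by (simp add: diff_def)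
  qed
  have good: "diff h = 0" if h: "h \<in> H" "h \<notin> Bad" for h
  proof -
    have "\<forall>g. \<exists>p. g < m \<longrightarrow> p < k \<and> \<not> covers_edge m k h S g p"
      using h by (auto simp: Bad_def covered_def)
    then obtain e where e: "\<And>g. g < m \<Longrightarrow> e g < k" "\<And>g. g < m \<Longrightarrow> \<not> covers_edge m k h S g (e g)"
      by metis
    have "(\<Sum>X\<in>W (- 1). acc h X) = (\<Sum>X\<in>W 1. acc h (flip_signs m e X))"
      unfolding W_def by (rule sum_sign_patterns_flip) (rule e)
    then show ?thesis
      using answers_flip_signs[OF S, of m k h e] e by (simp add: diff_def acc_def acceptance_def)
  qed
  have "card Bad \<le> (\<Sum>g<m. card (covered g))" unfolding Bad_def by (rule card_UN_le) simp
  also have "\<dots> \<le> (\<Sum>g<m. q ^ r)"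
  proof (rule sum_mono)
    fix g
    have "finite S" using S finite_subset by blast
    from card_shifts_covering_cycle[OF this, of r m g]
    have "card (covered g) \<le> card S ^ r" by (simp add: covered_def H_def k_def)
    also have "\<dots> \<le> q ^ r" using q by (intro power_mono) auto
    finally show "card (covered g) \<le> q ^ r" .
  qed
  finally have "card Bad \<le> m * q ^ r" by simp
  then have card_Bad: "real (card Bad) \<le> real m * real q ^ r"
    by (metis of_nat_le_iff of_nat_mult of_nat_power)
  have "(\<Sum>h\<in>H. diff h) = (\<Sum>h\<in>Bad. diff h)"
    by (rule sum.mono_neutral_right) (use H good in \<open>auto simp: Bad_def covered_def\<close>)
  also have "\<dots> \<le> (\<Sum>h\<in>Bad. real (card (W 1)))" by (intro sum_mono bad)
  also have "\<dots> \<le> real m * real q ^ r * real (card (W 1))"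
    using card_Bad by (simp add: mult_right_mono)
  finally show ?thesis
    by (simp add: diff_def sum_subtractf acc_def W_def k_def sum.cartesian_product)
qed

lemma output_dist_True_eq_integral:
  "pmf (output_dist T A) True = (\<integral>S. acceptance T S A \<partial>measure_pmf (query_dist T))"
  by (simp add: output_dist_def pmf_bind acceptance_def)

lemma solver_separates_families:
  fixes P :: "'i \<Rightarrow> real mat" and N :: "'j \<Rightarrow> real mat"
  assumes solves: "solves_psd_testing n \<epsilon> T" and fin: "finite I" "finite J" and card: "card I = card J"
    and P: "\<And>i. i \<in> I \<Longrightarrow> bounded_input n (P i) \<and> psd n (P i)"
    and N: "\<And>j. j \<in> J \<Longrightarrow> bounded_input n (N j) \<and> \<epsilon> * (real n)\<^sup>2 \<le> sq_dist_psd n (N j)"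
    and gap: "\<And>S. S \<in> set_pmf (query_dist T) \<Longrightarrow>
      (\<Sum>i\<in>I. acceptance T S (P i)) - (\<Sum>j\<in>J. acceptance T S (N j)) \<le> c"
  shows "real (card I) / 3 \<le> c"
proof -
  let ?D = "query_dist T"
  have int: "integrable (measure_pmf ?D) (\<lambda>S. acceptance T S A)" for A
    by (rule measure_pmf.integrable_const_bound[where B = 1]) (auto simp: acceptance_def pmf_le_1)
  have "real (card I) * (2 / 3) \<le> (\<Sum>i\<in>I. pmf (output_dist T (P i)) True)"
    using P solves by (intro sum_bounded_below) (auto simp: solves_psd_testing_def)
  moreover have "(\<Sum>j\<in>J. pmf (output_dist T (N j)) True) \<le> real (card J) * (1 / 3)"
    using N solves by (intro sum_bounded_above) (auto simp: solves_psd_testing_def pmf_False_conv_True)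
  moreover have "(\<Sum>i\<in>I. pmf (output_dist T (P i)) True) - (\<Sum>j\<in>J. pmf (output_dist T (N j)) True)
      = (\<integral>S. (\<Sum>i\<in>I. acceptance T S (P i)) - (\<Sum>j\<in>J. acceptance T S (N j)) \<partial>measure_pmf ?D)"
    by (simp add: output_dist_True_eq_integral int)
  moreover have "\<dots> \<le> c"
    using gap by (intro measure_pmf.integral_le_const Bochner_Integration.integrable_diff
        Bochner_Integration.integrable_sum int) (auto simp: AE_measure_pmf_iff)
  ultimately show ?thesis using card by simp
qed

subsection \<open>The query bound\<close>

lemma query_lower_bound:
  assumes solves: "solves_psd_testing n \<epsilon> T" and queries: "makes_at_most_queries n T q"
    and r: "2 \<le> r" and m: "0 < m" "m \<le> 2 ^ r" and s: "0 < n div (2 * r * m)"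
    and far: "\<epsilon> * (real n)\<^sup>2 \<le> real m * (2 * real (n div (2 * r * m)) / (real (2 * r))\<^sup>2)\<^sup>2"
  shows "(real m)\<^sup>2 / 4 \<le> real q"
proof (rule ccontr)
  assume "\<not> ?thesis"
  then have q: "real q \<le> (real m)\<^sup>2 / 4" by simp
  define H where "H = {..<2 * r} \<rightarrow>\<^sub>E {..<m}"
  define W where "W b = sign_patterns m (2 * r) b" for b
  define w where "w = real (card (W 1))"
  have w: "0 < w" using card_sign_patterns_pos by (simp add: w_def W_def)
  have H: "finite H" unfolding H_def by (intro finite_PiE) auto
  have card_H: "real (card H) = real m ^ (2 * r)" by (simp add: H_def card_PiE)
  have card_W: "card (W (- 1)) = card (W 1)"
    unfolding W_def using r by (intro card_sign_patterns_uminus) simp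
  have "real (card (H \<times> W (- 1))) / 3 \<le> real m * real q ^ r * w"
  proof (rule solver_separates_families[OF solves, where J = "H \<times> W 1"
      and P = "\<lambda>(h, X). cycle_mat n m (2 * r) h X" and N = "\<lambda>(h, X). cycle_mat n m (2 * r) h X"])
    fix z assume "z \<in> H \<times> W (- 1)"
    then show "bounded_input n (case z of (h, X) \<Rightarrow> cycle_mat n m (2 * r) h X) \<and>
        psd n (case z of (h, X) \<Rightarrow> cycle_mat n m (2 * r) h X)"
      using r by (auto simp: W_def intro!: cycle_mat_bounded cycle_mat_psd)
  next
    fix z assume "z \<in> H \<times> W 1"
    then show "bounded_input n (case z of (h, X) \<Rightarrow> cycle_mat n m (2 * r) h X) \<and>
        \<epsilon> * (real n)\<^sup>2 \<le> sq_dist_psd n (case z of (h, X) \<Rightarrow> cycle_mat n m (2 * r) h X)"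
      using r s
      by (auto simp: W_def intro!: cycle_mat_bounded order.trans[OF far] cycle_mat_far)
  next
    fix S assume "S \<in> set_pmf (query_dist T)"
    then have S: "S \<subseteq> {..<n} \<times> {..<n}" "card S \<le> q"
      using queries by (auto simp: makes_at_most_queries_def)
    show "(\<Sum>z\<in>H \<times> W (- 1). acceptance T S (case z of (h, X) \<Rightarrow> cycle_mat n m (2 * r) h X))
      - (\<Sum>z\<in>H \<times> W 1. acceptance T S (case z of (h, X) \<Rightarrow> cycle_mat n m (2 * r) h X))
      \<le> real m * real q ^ r * w"
      using sum_acceptance_diff_le[OF S, where r = r and m = m and T = T] r
      by (simp add: H_def W_def w_def case_prod_beta)
  qed (use H card_W in \<open>auto simp: W_def card_cartesian_product\<close>)
  then have "real m ^ (2 * r) / 3 * w \<le> real m * real q ^ r * w"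
    by (simp add: card_cartesian_product card_H card_W w_def)
  then have "real m ^ (2 * r) / 3 \<le> real m * real q ^ r" using w by simp
  also have "\<dots> \<le> real m * ((real m)\<^sup>2 / 4) ^ r"
    using q by (intro mult_left_mono power_mono) auto
  also have "\<dots> = real m ^ (2 * r) * (real m / 4 ^ r)"
    by (simp add: power_divide power_mult)
  finally have "1 / 3 \<le> real m / 4 ^ r" using m by (simp add: field_simps)
  also have "\<dots> \<le> 2 ^ r / 4 ^ r"
    using m by (intro divide_right_mono) (auto simp: of_nat_le_iff[symmetric] simp del: of_nat_le_iff)
  also have "\<dots> = (1 / 2) ^ r" by (simp flip: power_divide)
  also have "\<dots> \<le> (1 / 2) ^ 2" using r by (intro power_decreasing) auto
  finally show False by (simp add: power2_eq_square)
qed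

lemma at_least_one_query:
  assumes solves: "solves_psd_testing n \<epsilon> T" and queries: "makes_at_most_queries n T q"
    and n: "0 < n" and \<epsilon>: "\<epsilon> \<le> 1"
  shows "1 \<le> q"
proof (rule ccontr)
  assume "\<not> ?thesis"
  then have q: "q = 0" by simp
  define J where "J = mat n n (\<lambda>_. - 1 :: real)"
  have "real (card {()}) / 3 \<le> 0"
  proof (rule solver_separates_families[OF solves, where P = "\<lambda>_. 0\<^sub>m n n" and N = "\<lambda>_. J"])
    show "bounded_input n (0\<^sub>m n n) \<and> psd n (0\<^sub>m n n)"
      by (auto simp: bounded_input_def psd_def symmetric_matrix_def scalar_prod_def)
    have "real 1 * ((real n)\<^sup>2 / real n)\<^sup>2 \<le> sq_dist_psd n J"
      by (rule sq_dist_psd_ge[where v = "\<lambda>_ _. 1" and c = "\<lambda>_. 0"])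
        (use n in \<open>auto simp: J_def power2_eq_square\<close>)
    then have "(real n)\<^sup>2 \<le> sq_dist_psd n J" using n by (simp add: power2_eq_square)
    moreover have "\<epsilon> * (real n)\<^sup>2 \<le> 1 * (real n)\<^sup>2" using \<epsilon> by (intro mult_right_mono) auto
    ultimately show "bounded_input n J \<and> \<epsilon> * (real n)\<^sup>2 \<le> sq_dist_psd n J"
      by (auto simp: J_def bounded_input_def symmetric_matrix_def)
    fix S assume "S \<in> set_pmf (query_dist T)"
    then have "S \<subseteq> {..<n} \<times> {..<n}" "card S = 0"
      using queries q by (auto simp: makes_at_most_queries_def)
    then have "S = {}" by (metis card_0_eq finite_SigmaI finite_lessThan finite_subset)
    then show "(\<Sum>i\<in>{()}. acceptance T S (0\<^sub>m n n)) - (\<Sum>j\<in>{()}. acceptance T S J) \<le> 0"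
      by (simp add: acceptance_def answers_def restrict_def)
  qed auto
  then show False by simp
qed

theorem mainTheorem4:
  shows "\<exists>c > 0. \<exists>k :: nat. \<forall>(\<epsilon> :: real) (n :: nat) (T :: nonadaptive_algorithm) (q :: nat).
    0 < \<epsilon> \<and> \<epsilon> \<le> 1 \<and> real n \<ge> 1 / \<epsilon> \<and>
    makes_at_most_queries n T q \<and> solves_psd_testing n \<epsilon> T \<longrightarrow>
    real q \<ge> c * (1 / \<epsilon>\<^sup>2) / (1 + ln (1 / \<epsilon>)) ^ k"
proof (intro exI[of _ "1 / (16 * 6 ^ 12) :: real"] exI[of _ "12 :: nat"] conjI allI impI)
  show "(0::real) < 1 / (16 * 6 ^ 12)" by simp
  fix \<epsilon> :: real and n :: nat and T :: nonadaptive_algorithm and q :: nat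
  assume "0 < \<epsilon> \<and> \<epsilon> \<le> 1 \<and> real n \<ge> 1 / \<epsilon> \<and>
    makes_at_most_queries n T q \<and> solves_psd_testing n \<epsilon> T"
  then have \<epsilon>: "0 < \<epsilon>" "\<epsilon> \<le> 1" and n: "1 / \<epsilon> \<le> real n"
    and T: "makes_at_most_queries n T q" "solves_psd_testing n \<epsilon> T" by auto
  define L where "L = 1 + ln (1 / \<epsilon>)"
  define r where "r = nat \<lceil>2 * L\<rceil>"
  define k where "k = 2 * r"
  define m where "m = nat \<lfloor>1 / (\<epsilon> * real k ^ 6)\<rfloor>"
  have inv_ge: "1 \<le> 1 / \<epsilon>" using \<epsilon> by simp
  then have L: "1 \<le> L" by (simp add: L_def)
  have r_ge: "2 * L \<le> real r" unfolding r_def by linarith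
  have r_le: "real r \<le> 3 * L" unfolding r_def using L by linarith
  have r2: "2 \<le> r" using r_ge L by linarith
  have k: "0 < k" "real k \<le> 6 * L" using r2 r_le by (auto simp: k_def)
  have k6: "real k ^ 6 \<le> (6 * L) ^ 6" using k by (intro power_mono) auto
  have pos: "0 < \<epsilon> * real k ^ 6" using \<epsilon> k by simp
  have npos: "0 < n" using n inv_ge by (metis not_gr0 of_nat_0 order.trans not_one_le_zero)
  have target: "1 / (16 * 6 ^ 12) * (1 / \<epsilon>\<^sup>2) / L ^ 12 \<le> (x / 4)\<^sup>2"
    if "1 / \<epsilon> \<le> x * (6 * L) ^ 6" for x
  proof -
    define y where "y = 1 / \<epsilon>\<^sup>2"
    have "(1 / \<epsilon>)\<^sup>2 \<le> (x * (6 * L) ^ 6)\<^sup>2" using that \<epsilon> by (intro power_mono) auto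
    also have "\<dots> = x\<^sup>2 * (6 ^ 12 * L ^ 12)" by (simp add: power_mult_distrib flip: power_mult)
    finally have "y \<le> x\<^sup>2 * (6 ^ 12 * L ^ 12)" by (simp add: y_def power_divide)
    then show ?thesis unfolding y_def[symmetric] using L by (simp add: field_simps power_divide)
  qed
  show "1 / (16 * 6 ^ 12) * (1 / \<epsilon>\<^sup>2) / (1 + ln (1 / \<epsilon>)) ^ 12 \<le> real q"
  proof (cases "m = 0")
    case True
    then have "1 / (\<epsilon> * real k ^ 6) < 1" by (simp add: m_def)
    then have "1 / \<epsilon> \<le> real k ^ 6" using \<epsilon> k by (simp add: field_simps)
    then have "1 / \<epsilon> \<le> 1 * (6 * L) ^ 6" using k6 by linarith
    from target[OF this] at_least_one_query[OF T(2,1) npos \<epsilon>(2)] show ?thesis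
      unfolding L_def[symmetric] by (simp add: power_divide)
  next
    case False
    then have m: "0 < m" by simp
    have m_le: "real m \<le> 1 / (\<epsilon> * real k ^ 6)"
      using pos by (simp add: m_def)
    have m_ge: "1 / (\<epsilon> * real k ^ 6) \<le> 2 * real m"
      using m pos unfolding m_def by linarith
    have mk: "real m * real k ^ 6 \<le> 1 / \<epsilon>" using m_le \<epsilon> k by (simp add: field_simps)
    have k1: "1 \<le> real k" using k by simp
    have "real k \<le> real k ^ 6" using power_increasing[of 1 6 "real k"] k1 by simp
    from mult_left_mono[OF this, of "real m"]
    have "real (k * m) \<le> real m * real k ^ 6" by (simp add: mult.commute)
    then have "real (k * m) \<le> real n" using mk n by linarith
    then have km: "k * m \<le> n" by (simp only: of_nat_le_iff)
    define s where "s = n div (k * m)"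
    have s: "0 < s" using km k m by (simp add: s_def div_greater_zero_iff)
    have "n < k * m * (s + 1)" unfolding s_def using k m dividend_less_times_div[of "k * m" n] by simp
    also have "\<dots> \<le> k * m * (2 * s)" using s by (intro mult_left_mono) auto
    finally have "real n \<le> real (k * m * (2 * s))" by (simp only: of_nat_le_iff)
    then have n_s: "real n / (real k * real m) \<le> 2 * real s" using k m by (simp add: field_simps)
    have "\<epsilon> * (real n)\<^sup>2 \<le> (1 / (real m * real k ^ 6)) * (real n)\<^sup>2"
      using mk \<epsilon> k m by (intro mult_right_mono) (auto simp: field_simps)
    also have "\<dots> = real m * ((real n / (real k * real m)) / (real k)\<^sup>2)\<^sup>2"
      using k m by (simp add: field_simps eval_nat_numeral)
    also have "\<dots> \<le> real m * (2 * real s / (real k)\<^sup>2)\<^sup>2"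
      using n_s by (intro mult_left_mono power_mono divide_right_mono) auto
    finally have far: "\<epsilon> * (real n)\<^sup>2 \<le> real m * (2 * real s / (real k)\<^sup>2)\<^sup>2" .
    have m2: "m \<le> 2 ^ r"
    proof -
      have "real m * 1 \<le> real m * real k ^ 6" using k1 by (intro mult_left_mono) auto
      then have "real m \<le> 1 / \<epsilon>" using mk by linarith
      also have "\<dots> = exp (ln (1 / \<epsilon>))" using \<epsilon> by simp
      also have "\<dots> \<le> exp (real r / 2)" using r_ge L by (simp add: L_def)
      also have "\<dots> \<le> exp (real r * ln 2)"
        using ln2_ge_two_thirds by (simp add: mult_left_mono[of "1/2" "ln 2" "real r", simplified])
      also have "\<dots> = 2 ^ r" by (simp add: exp_of_nat_mult)
      finally show ?thesis by (metis of_nat_le_iff of_nat_numeral of_nat_power)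
    qed
    have "1 / \<epsilon> \<le> 2 * real m * real k ^ 6" using m_ge \<epsilon> k by (simp add: field_simps)
    also have "\<dots> \<le> 2 * real m * (6 * L) ^ 6" using k6 by (intro mult_left_mono) auto
    finally have "1 / (16 * 6 ^ 12) * (1 / \<epsilon>\<^sup>2) / L ^ 12 \<le> (2 * real m / 4)\<^sup>2" by (rule target)
    also have "\<dots> = (real m)\<^sup>2 / 4" by (simp add: power2_eq_square)
    also have "\<dots> \<le> real q"
      using query_lower_bound[OF T(2,1) r2 m m2] far s by (simp add: k_def s_def)
    finally show ?thesis unfolding L_def .
  qed
qed

end
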